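(* Let $p$ be a prime with $p\equiv 3 \pmod 4$ and let $d=2$ or $d=2^{-1}$ in $\mathbb{F}_p$. Then $$\sum_{j=0}^{\frac{p-1}{2}} d^{j}\left(C_{\frac{p-1}{2}}^{j}\right)^{2} \equiv 0 \pmod p,$$ and $\overline{N}_{d[p]} = p+1$.
   Context: For $d\in\mathbb{F}_p^*$, $d\ne 1$, $E_d$ is the Edwards curve $x^2+y^2=1+dx^2y^2$ over $\mathbb{F}_p$. $\overline{N}_{d[p]}$ denotes the number of points over $\mathbb{F}_p$ of the projective Edwards curve completed by its points at infinity, i.e. the number of $\mathbb{F}_p$-points of the nonsingular projective model of $E_d$ (equivalently, of the elliptic curve $v^2=(d-1)u^3+2(d+1)u^2+(d-1)u$ including its point at infinity). $C_n^j=\binom{n}{j}$. *)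

theory Defs
  imports "Berlekamp_Zassenhaus.Finite_Field"
begin

text \<open>
  The projective line over a field: nonzero pairs modulo nonzero scalars. The pair \<open>(X, Z)\<close>
  represents the affine value \<open>X / Z\<close>, and \<open>(1, 0)\<close> the point at infinity.
\<close>

definition proj_rel :: "(('a::field \<times> 'a) \<times> ('a \<times> 'a)) set" where
  "proj_rel = {(u, v). u \<noteq> (0, 0) \<and> v \<noteq> (0, 0) \<and>
     (\<exists>c. c \<noteq> 0 \<and> v = (c * fst u, c * snd u))}"

definition proj_line :: "('a::field \<times> 'a) set set" where
  "proj_line = {v. v \<noteq> (0, 0)} // proj_rel"

definition edwards_affine :: "'a::field \<Rightarrow> ('a \<times> 'a) set" where
  "edwards_affine d = {(x, y). x ^ 2 + y ^ 2 = 1 + d * x ^ 2 * y ^ 2}"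

text \<open>
  Substituting \<open>x = X / Z\<close>, \<open>y = Y / W\<close> into the affine equation and clearing
  denominators gives a bihomogeneous equation of bidegree \<open>(2, 2)\<close>.
\<close>

definition edwards_form :: "'a::field \<Rightarrow> 'a \<times> 'a \<Rightarrow> 'a \<times> 'a \<Rightarrow> bool" where
  "edwards_form d u v = (case u of (X, Z) \<Rightarrow> case v of (Y, W) \<Rightarrow>
     X ^ 2 * W ^ 2 + Y ^ 2 * Z ^ 2 = Z ^ 2 * W ^ 2 + d * X ^ 2 * Y ^ 2)"

text \<open>
  The rational points of the completed Edwards curve, that is, of the closure of the affine
  curve in the product of two projective lines. The closure in the projective plane would be
  singular at its two points at infinity; the one used here is nonsingular whenever the
  characteristic is not 2 and \<open>d\<close> is neither 0 nor 1 (lemma \<open>edwards_nonsingular\<close>), so it is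
  the nonsingular projective model of the Edwards curve.
\<close>

definition edwards_points :: "'a::field \<Rightarrow> (('a \<times> 'a) set \<times> ('a \<times> 'a) set) set" where
  "edwards_points d = {(P, Q) \<in> proj_line \<times> proj_line. \<exists>u\<in>P. \<exists>v\<in>Q. edwards_form d u v}"

lemma equiv_proj_rel: "equiv {v. v \<noteq> (0, 0)} (proj_rel :: (('a::field \<times> 'a) \<times> ('a \<times> 'a)) set)"
proof (rule equivI)
  show "proj_rel \<subseteq> {v. v \<noteq> (0, 0)} \<times> {v. v \<noteq> (0 :: 'a, 0 :: 'a)}"
    by (auto simp: proj_rel_def)
  show "refl_on {v. v \<noteq> (0, 0)} (proj_rel :: (('a \<times> 'a) \<times> ('a \<times> 'a)) set)"
    by (auto simp: refl_on_def proj_rel_def intro: exI[of _ 1])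
  show "sym (proj_rel :: (('a \<times> 'a) \<times> ('a \<times> 'a)) set)"
  proof (rule symI)
    fix u v :: "'a \<times> 'a"
    assume "(u, v) \<in> proj_rel"
    then obtain c where c: "u \<noteq> (0, 0)" "v \<noteq> (0, 0)" "c \<noteq> 0" "v = (c * fst u, c * snd u)"
      unfolding proj_rel_def by blast
    then have "u = (inverse c * fst v, inverse c * snd v)" "inverse c \<noteq> 0"
      by (simp_all add: mult.assoc [symmetric])
    with c(1,2) show "(v, u) \<in> proj_rel"
      unfolding proj_rel_def by blast
  qed
  show "trans (proj_rel :: (('a \<times> 'a) \<times> ('a \<times> 'a)) set)"
  proof (rule transI)
    fix u v w :: "'a \<times> 'a"
    assume "(u, v) \<in> proj_rel" "(v, w) \<in> proj_rel"
    then obtain b c where *: "u \<noteq> (0, 0)" "w \<noteq> (0, 0)" "b \<noteq> 0" "c \<noteq> 0"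
      "v = (b * fst u, b * snd u)" "w = (c * fst v, c * snd v)"
      by (auto simp: proj_rel_def)
    then have "w = (c * b * fst u, c * b * snd u)" "c * b \<noteq> 0"
      by simp_all
    with *(1,2) show "(u, w) \<in> proj_rel"
      unfolding proj_rel_def by blast
  qed
qed

lemma edwards_form_scale:
  fixes d b c :: "'a::field"
  assumes "b \<noteq> 0" and "c \<noteq> 0"
  shows "edwards_form d (b * X, b * Z) (c * Y, c * W) \<longleftrightarrow> edwards_form d (X, Z) (Y, W)"
proof -
  have "edwards_form d (b * X, b * Z) (c * Y, c * W) \<longleftrightarrow>
      (b * c) ^ 2 * (X ^ 2 * W ^ 2 + Y ^ 2 * Z ^ 2) =
      (b * c) ^ 2 * (Z ^ 2 * W ^ 2 + d * X ^ 2 * Y ^ 2)"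
    by (simp add: edwards_form_def power_mult_distrib algebra_simps)
  then show ?thesis
    using assms by (simp add: edwards_form_def)
qed

lemma proj_class_in_proj_line: "v \<noteq> (0, 0) \<Longrightarrow> proj_rel `` {v} \<in> proj_line"
  by (simp add: proj_line_def quotientI)

lemma edwards_points_class_iff:
  fixes u v :: "'a::field \<times> 'a"
  assumes "u \<noteq> (0, 0)" and "v \<noteq> (0, 0)"
  shows "(proj_rel `` {u}, proj_rel `` {v}) \<in> edwards_points d \<longleftrightarrow> edwards_form d u v"
proof
  assume "(proj_rel `` {u}, proj_rel `` {v}) \<in> edwards_points d"
  then obtain u' v' where "(u, u') \<in> proj_rel" "(v, v') \<in> proj_rel" "edwards_form d u' v'"
    by (auto simp: edwards_points_def)
  then obtain b c where "b \<noteq> 0" "c \<noteq> 0"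
    "edwards_form d (b * fst u, b * snd u) (c * fst v, c * snd v)"
    by (auto simp: proj_rel_def)
  then have "edwards_form d (fst u, snd u) (fst v, snd v)"
    using edwards_form_scale by blast
  then show "edwards_form d u v"
    by simp
next
  assume "edwards_form d u v"
  moreover have "u \<in> proj_rel `` {u}" "v \<in> proj_rel `` {v}"
    using assms equiv_class_self[OF equiv_proj_rel] by blast+
  ultimately show "(proj_rel `` {u}, proj_rel `` {v}) \<in> edwards_points d"
    using assms unfolding edwards_points_def by (auto intro: proj_class_in_proj_line)
qed

lemma edwards_points_affine_iff:
  "(proj_rel `` {(x, 1)}, proj_rel `` {(y, 1)}) \<in> edwards_points d \<longleftrightarrow> (x, y) \<in> edwards_affine d"
  by (subst edwards_points_class_iff) (simp_all add: edwards_form_def edwards_affine_def)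

text \<open>
  The four expressions are the partial derivatives, with respect to \<open>X\<close>, \<open>Z\<close>, \<open>Y\<close> and \<open>W\<close>, of
  the form \<open>X\<^sup>2W\<^sup>2 + Y\<^sup>2Z\<^sup>2 - Z\<^sup>2W\<^sup>2 - dX\<^sup>2Y\<^sup>2\<close>. The lemma holds over every field, so the curve is
  nonsingular over an algebraic closure as well.
\<close>

lemma edwards_nonsingular:
  fixes d X Y Z W :: "'a::field"
  assumes "(2 :: 'a) \<noteq> 0" and "d \<noteq> 0" and "d \<noteq> 1"
    and "(X, Z) \<noteq> (0, 0)" and "(Y, W) \<noteq> (0, 0)"
  shows "\<not> (2 * X * W ^ 2 - 2 * d * X * Y ^ 2 = 0 \<and> 2 * Y ^ 2 * Z - 2 * Z * W ^ 2 = 0 \<and>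
            2 * Y * Z ^ 2 - 2 * d * X ^ 2 * Y = 0 \<and> 2 * X ^ 2 * W - 2 * Z ^ 2 * W = 0)"
proof
  assume *: "2 * X * W ^ 2 - 2 * d * X * Y ^ 2 = 0 \<and> 2 * Y ^ 2 * Z - 2 * Z * W ^ 2 = 0 \<and>
            2 * Y * Z ^ 2 - 2 * d * X ^ 2 * Y = 0 \<and> 2 * X ^ 2 * W - 2 * Z ^ 2 * W = 0"
  have "2 * X * (W ^ 2 - d * Y ^ 2) = 0" "2 * Z * (Y ^ 2 - W ^ 2) = 0"
    "2 * Y * (Z ^ 2 - d * X ^ 2) = 0" "2 * W * (X ^ 2 - Z ^ 2) = 0"
    using * by (simp_all add: algebra_simps)
  then have 1: "X = 0 \<or> W ^ 2 = d * Y ^ 2" and 2: "Z = 0 \<or> Y ^ 2 = W ^ 2"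
    and 3: "Y = 0 \<or> Z ^ 2 = d * X ^ 2" and 4: "W = 0 \<or> X ^ 2 = Z ^ 2"
    using assms(1) by auto
  show False
  proof (cases "X = 0")
    case True
    then have "Z \<noteq> 0"
      using assms(4) by simp
    with 2 3 True assms(5) show False
      by auto
  next
    case False
    with 1 have W: "W ^ 2 = d * Y ^ 2"
      by simp
    then have Y: "Y \<noteq> 0"
      using assms(5) by auto
    then have "W \<noteq> 0"
      using W assms(2) by auto
    with 3 4 Y have "d * X ^ 2 = X ^ 2"
      by simp
    with False assms(3) show False
      by simp
  qed
qed

end

theory Submission
  imports Defs
begin

text \<open>
  Let \<open>q\<close> be the number of field elements and \<open>\<chi>\<close> the quadratic character. Solving the curve
  equation for \<open>y\<^sup>2\<close> shows that the curve has \<open>q + 1 + \<chi>(d) + S\<close> points, where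
  \<open>S = (\<Sum>x. \<chi> ((1 - x\<^sup>2) (1 - d x\<^sup>2)))\<close>, and substituting \<open>t = x\<^sup>2\<close> turns this into
  \<open>q + 1 + (\<Sum>t. \<chi> (t (1 - t) (1 - d t)))\<close>. On the other hand, expanding
  \<open>(\<Sum>t. (t (1 - t) (1 - d t)) ^ ((q - 1) div 2))\<close> gives, up to sign, the sum of the
  \<open>d ^ j\<close> times squared binomial coefficients. Both sums over \<open>t\<close> are odd functions of the
  cubic, because \<open>q \<equiv> 3\<close> modulo 4. For \<open>d = 2\<close> the cubic changes sign under \<open>t \<mapsto> 1 - t\<close>,
  and for \<open>d = 1 / 2\<close> under \<open>t \<mapsto> 2 - t\<close>; so both sums vanish.
\<close>

section \<open>Sums over finite fields\<close>

lemma finite_field_power_card_minus_1: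
  fixes x :: "'a::finite_field"
  assumes "x \<noteq> 0"
  shows "x ^ (CARD('a) - 1) = 1"
proof -
  have "x * x ^ (CARD('a) - 1) = x ^ CARD('a)"
    using finite_UNIV_card_ge_0[where 'a = 'a] by (simp flip: power_Suc)
  then show ?thesis
    using assms by (simp add: finite_field_power_card_eq_same)
qed

text \<open>Translation by 1 permutes the field, so summing \<open>x + 1\<close> and summing
  \<open>x\<close> give the same result; the difference is \<open>CARD('a)\<close> copies of
  1.\<close>

lemma of_nat_card_finite_field: "(of_nat CARD('a) :: 'a::finite_field) = 0"
proof -
  have "(\<Sum>x\<in>UNIV. x + 1) = (\<Sum>x\<in>UNIV. x :: 'a)"
    by (rule sum.reindex_bij_witness[of _ "\<lambda>x. x - 1" "\<lambda>x. x + 1"]) auto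
  then show ?thesis
    by (simp add: sum.distrib)
qed

lemma card_finite_field_gt_1: "CARD('a::finite_field) > 1"
proof -
  have "card {0, 1 :: 'a} \<le> CARD('a)"
    by (rule card_mono) auto
  then show ?thesis
    by simp
qed

text \<open>Otherwise the polynomial \<open>X ^ r - 1\<close> would have more roots than its degree.
  This stands in for a generator of the multiplicative group.\<close>

lemma finite_field_exists_power_neq_1:
  assumes "0 < r" "r < CARD('a) - 1"
  shows "\<exists>g :: 'a::finite_field. g \<noteq> 0 \<and> g ^ r \<noteq> 1"
proof (rule ccontr)
  assume *: "\<not> ?thesis"
  define P :: "'a poly" where "P = monom 1 r + [:- 1:]"
  have "degree P = r"
    using assms unfolding P_def
    by (subst degree_add_eq_left) (auto simp: degree_monom_eq)
  have "CARD('a) - 1 = card (UNIV - {0 :: 'a})"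
    by (simp add: card_Diff_singleton)
  also have "\<dots> \<le> card {x. poly P x = 0}"
    by (rule card_mono) (use * in \<open>auto simp: P_def poly_monom\<close>)
  also have "\<dots> \<le> degree P"
    using \<open>degree P = r\<close> assms by (intro card_poly_roots_bound) auto
  finally show False
    using \<open>degree P = r\<close> assms by simp
qed

text \<open>If \<open>g ^ k \<noteq> 1\<close>, then scaling the summation variable by
  \<open>g\<close> multiplies the sum by \<open>g ^ k\<close>, which forces it to vanish. For
  \<open>k = CARD('a) - 1\<close> every nonzero \<open>x\<close> contributes 1.\<close>

lemma sum_power_finite_field:
  assumes "0 < k" "k < 2 * (CARD('a) - 1)"
  shows "(\<Sum>x\<in>UNIV. x ^ k :: 'a::finite_field) = (if k = CARD('a) - 1 then - 1 else 0)"
proof (cases "k = CARD('a) - 1")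
  case True
  have "(\<Sum>x\<in>UNIV. x ^ k :: 'a) = (\<Sum>x\<in>UNIV - {0}. x ^ k)"
    using assms by (intro sum.mono_neutral_right) auto
  also have "\<dots> = (\<Sum>x\<in>UNIV - {0 :: 'a}. 1)"
    unfolding True by (intro sum.cong refl finite_field_power_card_minus_1) simp
  also have "\<dots> = of_nat (CARD('a) - 1)"
    by (simp add: card_Diff_singleton)
  also have "\<dots> = - 1"
    using card_finite_field_gt_1[where 'a = 'a] by (simp add: of_nat_diff of_nat_card_finite_field)
  finally show ?thesis
    using True by simp
next
  case False
  obtain g :: 'a where g: "g \<noteq> 0" "g ^ k \<noteq> 1"
  proof (cases "k < CARD('a) - 1")
    case True
    with finite_field_exists_power_neq_1[of k] assms that show ?thesis
      by blast
  next
    case ge: False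
    \<comment> \<open>Since \<open>g ^ (CARD('a) - 1) = 1\<close>, the exponent may be reduced to a
      smaller one, still positive.\<close>
    define r where "r = k - (CARD('a) - 1)"
    have r: "0 < r" "r < CARD('a) - 1" "k = (CARD('a) - 1) + r"
      using assms ge False unfolding r_def by linarith+
    obtain g :: 'a where "g \<noteq> 0" "g ^ r \<noteq> 1"
      using finite_field_exists_power_neq_1 r by blast
    then have "g ^ k \<noteq> 1"
      unfolding r(3) power_add finite_field_power_card_minus_1[OF \<open>g \<noteq> 0\<close>] by simp
    with \<open>g \<noteq> 0\<close> that show ?thesis
      by blast
  qed
  have "(\<Sum>x\<in>UNIV. x ^ k) = (\<Sum>x\<in>UNIV. (g * x) ^ k)"
    by (rule sum.reindex_bij_witness[of _ "\<lambda>x. g * x" "\<lambda>x. x / g"]) (use g in auto)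
  also have "\<dots> = g ^ k * (\<Sum>x\<in>UNIV. x ^ k)"
    by (simp only: power_mult_distrib sum_distrib_left)
  finally have "(1 - g ^ k) * (\<Sum>x\<in>UNIV. x ^ k) = 0"
    by (simp add: left_diff_distrib)
  with g False show ?thesis
    by simp
qed

section \<open>The quadratic character\<close>

text \<open>The values are integers rather than field elements, so that point counts come out
  exactly and not only modulo the characteristic.\<close>

definition quad_char :: "'a::field \<Rightarrow> int" where
  "quad_char a = (if a = 0 then 0 else if \<exists>y. y ^ 2 = a then 1 else - 1)"

lemma quad_char_0 [simp]: "quad_char 0 = 0"
  by (simp add: quad_char_def)

lemma quad_char_square [simp]: "a \<noteq> 0 \<Longrightarrow> quad_char (a ^ 2) = 1"
  by (auto simp: quad_char_def)

lemma card_sqrts: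
  fixes a :: "'a::finite_field"
  assumes "(2 :: 'a) \<noteq> 0"
  shows "int (card {y. y ^ 2 = a}) = 1 + quad_char a"
proof (cases "\<exists>y. y ^ 2 = a")
  case True
  then obtain z where z: "z ^ 2 = a"
    by blast
  have roots: "{y. y ^ 2 = a} = {z, - z}"
    unfolding z[symmetric] by (auto simp: power2_eq_iff)
  show ?thesis
  proof (cases "z = 0")
    case True
    with z roots show ?thesis
      by (simp add: quad_char_def)
  next
    case False
    have "z \<noteq> - z"
    proof
      assume "z = - z"
      then have "2 * z = 0"
        by (metis add.right_inverse mult_2)
      with assms False show False
        by simp
    qed
    with False roots z show ?thesis
      by (auto simp: quad_char_def)
  qed
next
  case False
  then have "a \<noteq> 0"
    by (metis zero_power2)
  with False show ?thesis
    by (simp add: quad_char_def)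
qed

text \<open>Group the \<open>x\<close> by their square \<open>t\<close>: the fibre over
  \<open>t\<close> has \<open>1 + quad_char t\<close> elements.\<close>

lemma sum_quad_char_square:
  fixes f :: "'a::finite_field \<Rightarrow> int"
  assumes "(2 :: 'a) \<noteq> 0"
  shows "(\<Sum>x\<in>UNIV. f (x ^ 2)) = (\<Sum>t\<in>UNIV. (1 + quad_char t) * f t)"
proof -
  have "(\<Sum>x\<in>UNIV. f (x ^ 2)) = (\<Sum>t\<in>UNIV. \<Sum>x | x ^ 2 = t. f (x ^ 2))"
    using sum.group[of UNIV UNIV "\<lambda>x :: 'a. x ^ 2" "\<lambda>x. f (x ^ 2)"] by simp
  also have "\<dots> = (\<Sum>t\<in>UNIV. \<Sum>x | x ^ 2 = t. f t)"
    by (intro sum.cong) auto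
  also have "\<dots> = (\<Sum>t\<in>UNIV. (1 + quad_char t) * f t)"
    by (simp add: card_sqrts[OF assms])
  finally show ?thesis .
qed

text \<open>Counting the field by the fibres of squaring gives \<open>CARD('a)\<close> plus this
  sum.\<close>

lemma sum_quad_char:
  assumes "(2 :: 'a::finite_field) \<noteq> 0"
  shows "(\<Sum>x\<in>UNIV. quad_char (x :: 'a)) = 0"
  using sum_quad_char_square[OF assms, of "\<lambda>_. 1"] by (simp add: sum.distrib)

text \<open>A nonzero square factor does not change \<open>quad_char\<close>. For a nonsquare
  \<open>a\<close>, the vanishing of the complete character sum settles all \<open>b\<close> at
  once.\<close>

lemma quad_char_mult:
  fixes a b :: "'a::finite_field"
  assumes two: "(2 :: 'a) \<noteq> 0"
  shows "quad_char (a * b) = quad_char a * quad_char b"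
proof -
  have square: "quad_char (u * v) = quad_char v" if u: "u \<noteq> 0" "\<exists>y. y ^ 2 = u" for u v :: 'a
  proof -
    obtain y where "y ^ 2 = u"
      using u(2) by blast
    with u(1) have y: "y ^ 2 = u" "y \<noteq> 0"
      by auto
    have "(\<exists>z. z ^ 2 = u * v) \<longleftrightarrow> (\<exists>z. z ^ 2 = v)"
    proof
      assume "\<exists>z. z ^ 2 = u * v"
      then obtain z where "z ^ 2 = u * v" ..
      then have "(z / y) ^ 2 = v"
        using y by (auto simp: power_divide)
      then show "\<exists>z. z ^ 2 = v" ..
    next
      assume "\<exists>z. z ^ 2 = v"
      then obtain z where "z ^ 2 = v" ..
      then have "(y * z) ^ 2 = u * v"
        using y by (simp add: power_mult_distrib)
      then show "\<exists>z. z ^ 2 = u * v" ..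
    qed
    with that show ?thesis
      by (simp add: quad_char_def)
  qed
  consider "a = 0" | "a \<noteq> 0" "\<exists>y. y ^ 2 = a" | "a \<noteq> 0" "\<nexists>y. y ^ 2 = a"
    by blast
  then show ?thesis
  proof cases
    case 2
    then show ?thesis
      by (simp add: square) (simp add: quad_char_def)
  next
    case 3
    \<comment> \<open>Each \<open>f v\<close> is nonpositive and the \<open>f v\<close> sum to zero, so all of them vanish.\<close>
    define f :: "'a \<Rightarrow> int" where "f v = quad_char v + quad_char (a * v)" for v
    have "(\<Sum>v\<in>UNIV. quad_char (a * v)) = (\<Sum>v\<in>UNIV. quad_char (v :: 'a))"
      by (rule sum.reindex_bij_witness[of _ "\<lambda>v. v / a" "\<lambda>v. a * v"]) (use 3 in auto)
    then have "(\<Sum>v\<in>UNIV. - f v) = 0"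
      by (simp add: f_def sum.distrib sum_negf sum_subtractf sum_quad_char[OF two])
    moreover have "- f v \<ge> 0" for v
    \<comment> \<open>For a nonsquare \<open>v\<close> the first term of \<open>f v\<close> is -1
      and the second at most 1; for a nonzero square \<open>v\<close> the second equals
      \<open>quad_char a\<close>, which is -1.\<close>
    proof (cases "v = 0 \<or> (\<nexists>y. y ^ 2 = v)")
      case True
      then show ?thesis
        by (auto simp: f_def quad_char_def)
    next
      case False
      then have "quad_char (a * v) = quad_char a"
        using square[of v a] by (simp add: mult.commute)
      with False 3 show ?thesis
        by (simp add: f_def) (simp add: quad_char_def)
    qed
    ultimately have "- f b = 0"
      by (subst (asm) sum_nonneg_eq_0_iff) auto
    moreover have "quad_char a = - 1"
      using 3 by (simp add: quad_char_def)
    ultimately show ?thesis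
      by (simp add: f_def)
  qed simp
qed

text \<open>Half of \<open>CARD('a) - 1\<close> is odd, so raising \<open>y ^ 2 = - 1\<close> to
  that power would give \<open>1 = - 1\<close>.\<close>

lemma quad_char_uminus_1:
  assumes "CARD('a::finite_field) mod 4 = 3"
  shows "quad_char (- 1 :: 'a) = - 1"
proof -
  have two: "(2 :: 'a) \<noteq> 0"
  proof
    assume "(2 :: 'a) = 0"
    moreover define k where "k = CARD('a) div 2"
    have "CARD('a) = 2 * k + 1"
      unfolding k_def using assms by presburger
    then have "(of_nat CARD('a) :: 'a) = 2 * of_nat k + 1"
      by simp
    ultimately show False
      by (simp add: of_nat_card_finite_field)
  qed
  have "y ^ 2 \<noteq> - 1" for y :: 'a
  proof
    assume y: "y ^ 2 = - 1"
    then have "y \<noteq> 0"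
      by auto
    define k where "k = CARD('a) div 4"
    have k: "CARD('a) - 1 = 2 * (2 * k + 1)"
      unfolding k_def using assms by presburger
    have "1 = (y ^ 2) ^ (2 * k + 1)"
      using finite_field_power_card_minus_1[OF \<open>y \<noteq> 0\<close>] unfolding k power_mult by simp
    then have "(1 :: 'a) = - 1"
      unfolding y by simp
    then have "(2 :: 'a) = 0"
      by (metis add.right_inverse one_add_one)
    with two show False ..
  qed
  then show ?thesis
    by (simp add: quad_char_def)
qed

text \<open>Dividing by the square \<open>(1 - t) ^ 2\<close> leaves the character of a fractional
  linear function of \<open>t\<close>, invertible because \<open>d \<noteq> 1\<close>. It takes
  every value except \<open>d\<close>, its value at infinity.\<close>

lemma sum_quad_char_linear_product:
  fixes d :: "'a::finite_field"
  assumes two: "(2 :: 'a) \<noteq> 0" and "d \<noteq> 1"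
  shows "(\<Sum>t\<in>UNIV. quad_char ((1 - t) * (1 - d * t))) = - quad_char d"
proof -
  have "(\<Sum>t\<in>UNIV. quad_char ((1 - t) * (1 - d * t))) =
      (\<Sum>t\<in>UNIV - {1}. quad_char ((1 - t) * (1 - d * t)))"
    by (rule sum.mono_neutral_right) auto
  also have "\<dots> = (\<Sum>t\<in>UNIV - {1}. quad_char ((1 - d * t) / (1 - t)))"
  proof (rule sum.cong [OF refl])
    fix t :: 'a
    assume "t \<in> UNIV - {1}"
    then have "1 - t \<noteq> 0"
      by simp
    then have eq: "(1 - t) * (1 - d * t) = (1 - t) ^ 2 * ((1 - d * t) / (1 - t))"
      by (simp add: power2_eq_square)
    show "quad_char ((1 - t) * (1 - d * t)) = quad_char ((1 - d * t) / (1 - t))"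
      unfolding eq quad_char_mult[OF two] using \<open>1 - t \<noteq> 0\<close> by simp
  qed
  also have "\<dots> = (\<Sum>s\<in>UNIV - {d}. quad_char s)"
  proof (rule sum.reindex_bij_witness[of _ "\<lambda>s. (s - 1) / (s - d)" "\<lambda>t. (1 - d * t) / (1 - t)"])
    fix t :: 'a
    assume "t \<in> UNIV - {1}"
    define s where "s = (1 - d * t) / (1 - t)"
    have "s * (1 - t) = 1 - d * t"
      using \<open>t \<in> UNIV - {1}\<close> by (simp add: s_def)
    then have s: "s - 1 = t * (s - d)"
      by (simp add: algebra_simps)
    then have "s \<noteq> d"
      using \<open>d \<noteq> 1\<close> by auto
    with s show "((1 - d * t) / (1 - t) - 1) / ((1 - d * t) / (1 - t) - d) = t"
      and "(1 - d * t) / (1 - t) \<in> UNIV - {d}"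
      unfolding s_def[symmetric] by simp_all
  next
    fix s :: 'a
    assume "s \<in> UNIV - {d}"
    define t where "t = (s - 1) / (s - d)"
    have t: "t * (s - d) = s - 1"
      using \<open>s \<in> UNIV - {d}\<close> by (simp add: t_def)
    then have "t \<noteq> 1"
      using \<open>d \<noteq> 1\<close> by auto
    moreover from t have "1 - d * t = s * (1 - t)"
      by (simp add: algebra_simps)
    ultimately show "(1 - d * ((s - 1) / (s - d))) / (1 - (s - 1) / (s - d)) = s"
      and "(s - 1) / (s - d) \<in> UNIV - {1}"
      unfolding t_def[symmetric] by simp_all
  qed simp
  also have "\<dots> = - quad_char d"
    using sum_quad_char[OF two] by (simp add: sum_diff1)
  finally show ?thesis .
qed

section \<open>Points of the completed curve\<close>

text \<open>Dividing by a nonzero second coordinate gives a representative \<open>(x, 1)\<close>.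
  Together with injectivity on these representatives, this reduces counting classes to counting
  normalised pairs.\<close>

lemma proj_line_eq:
  "proj_line = (\<lambda>u. proj_rel `` {u}) ` (range (\<lambda>x. (x, 1)) \<union> {(1 :: 'a::field, 0)})"
proof -
  have "proj_rel `` {(X, Z)} \<in> (\<lambda>u. proj_rel `` {u}) ` (range (\<lambda>x. (x, 1)) \<union> {(1 :: 'a, 0)})"
    if "(X, Z) \<noteq> (0, 0)" for X Z
  proof (cases "Z = 0")
    case True
    with that have "((1, 0), (X, Z)) \<in> proj_rel"
      by (auto simp: proj_rel_def)
    then have "proj_rel `` {(X, Z)} = proj_rel `` {(1, 0)}"
      using equiv_class_eq[OF equiv_proj_rel] by blast
    then show ?thesis
      by blast
  next
    case False
    then have "((X / Z, 1), (X, Z)) \<in> proj_rel"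
      by (auto simp: proj_rel_def)
    then have "proj_rel `` {(X, Z)} = proj_rel `` {(X / Z, 1)}"
      using equiv_class_eq[OF equiv_proj_rel] by blast
    then show ?thesis
      by blast
  qed
  moreover have "proj_rel `` {u} \<in> proj_line" if "u \<in> range (\<lambda>x. (x, 1)) \<union> {(1 :: 'a, 0)}" for u
    using that by (intro proj_class_in_proj_line) auto
  ultimately show ?thesis
    by (auto simp: proj_line_def elim!: quotientE)
qed

lemma inj_on_proj_class:
  "inj_on (\<lambda>u. proj_rel `` {u}) (range (\<lambda>x. (x, 1)) \<union> {(1 :: 'a::field, 0)})"
proof (rule inj_onI)
  fix u v :: "'a \<times> 'a"
  assume uv: "u \<in> range (\<lambda>x. (x, 1)) \<union> {(1, 0)}" "v \<in> range (\<lambda>x. (x, 1)) \<union> {(1, 0)}"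
    and "proj_rel `` {u} = proj_rel `` {v}"
  moreover from uv have "u \<noteq> (0, 0)" "v \<noteq> (0, 0)"
    by auto
  ultimately have "(u, v) \<in> proj_rel"
    using eq_equiv_class_iff[OF equiv_proj_rel] by blast
  with uv show "u = v"
    by (auto simp: proj_rel_def)
qed

lemma card_edwards_points_split:
  fixes d :: "'a::finite_field"
  assumes "d \<noteq> 0"
  shows "card (edwards_points d) = card (edwards_affine d) + 2 * card {x. d * x ^ 2 = 1}"
proof -
  define R where "R = range (\<lambda>x. (x, 1)) \<union> {(1 :: 'a, 0 :: 'a)}"
  define cl where "cl = (\<lambda>u. proj_rel `` {u :: 'a \<times> 'a})"
  define T where "T = {x. d * x ^ 2 = 1}"
  define F where "F = {(u, v) \<in> R \<times> R. edwards_form d u v}"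
  have line: "proj_line = cl ` R" and inj: "inj_on cl R"
    unfolding cl_def R_def by (rule proj_line_eq, rule inj_on_proj_class)
  have nonzero: "u \<noteq> (0, 0)" if "u \<in> R" for u
    using that by (auto simp: R_def)
  have "edwards_points d = map_prod cl cl ` F"
  proof -
    have iff: "(cl u, cl v) \<in> edwards_points d \<longleftrightarrow> edwards_form d u v" if "u \<in> R" "v \<in> R" for u v
      using edwards_points_class_iff[OF nonzero nonzero] that by (simp add: cl_def)
    show ?thesis
    proof (intro equalityI subsetI)
      fix P
      assume "P \<in> edwards_points d"
      moreover from this obtain u v where "P = (cl u, cl v)" "u \<in> R" "v \<in> R"
        by (auto simp: edwards_points_def line)
      ultimately show "P \<in> map_prod cl cl ` F"
        using iff by (force simp: F_def)
    next
      fix P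
      assume "P \<in> map_prod cl cl ` F"
      then show "P \<in> edwards_points d"
        using iff by (auto simp: F_def)
    qed
  qed
  moreover have "inj_on (map_prod cl cl) F"
    by (rule inj_on_subset[OF map_prod_inj_on[OF inj inj]]) (auto simp: F_def)
  ultimately have "card (edwards_points d) = card F"
    by (simp add: card_image)
  \<comment> \<open>\<open>?A\<close> is the affine part; in \<open>?B\<close> only \<open>y\<close>
    is infinite and in \<open>?C\<close> only \<open>x\<close>. With one coordinate at infinity the
    form reduces to \<open>d * x ^ 2 = 1\<close>, and with both to \<open>d = 0\<close>.\<close>
  also have "F = (\<lambda>(x, y). ((x, 1), (y, 1))) ` edwards_affine d \<union>
      ((\<lambda>x. ((x, 1), (1, 0))) ` T \<union> (\<lambda>x. ((1, 0), (x, 1))) ` T)"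
    (is "_ = ?A \<union> (?B \<union> ?C)")
    using assms by (auto simp: F_def T_def R_def edwards_form_def edwards_affine_def)
  also have "card \<dots> = card ?A + (card ?B + card ?C)"
  proof -
    have "?A \<inter> (?B \<union> ?C) = {}"
      by (intro equals0I, elim IntE UnE imageE) auto
    moreover have "?B \<inter> ?C = {}"
      by (intro equals0I, elim IntE imageE) auto
    ultimately show ?thesis
      by (simp only: card_Un_disjoint finite)
  qed
  also have "card ?A = card (edwards_affine d)"
    by (rule card_image) (auto simp: inj_on_def)
  also have "card ?B = card T"
    by (rule card_image) (auto simp: inj_on_def)
  also have "card ?C = card T"
    by (rule card_image) (auto simp: inj_on_def)
  finally show ?thesis
    by (simp add: T_def)
qed

text \<open>The elements \<open>d\<close> and \<open>1 / d\<close> differ by the square factor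
  \<open>d ^ 2\<close>, so they have the same character.\<close>

lemma card_scaled_square_eq_1:
  fixes d :: "'a::finite_field"
  assumes two: "(2 :: 'a) \<noteq> 0" and "d \<noteq> 0"
  shows "int (card {x. d * x ^ 2 = 1}) = 1 + quad_char d"
proof -
  have "{x. d * x ^ 2 = 1} = {x. x ^ 2 = 1 / d}"
    using assms by (auto simp: field_simps)
  moreover have "d ^ 2 * (1 / d) = d"
    by (simp add: power2_eq_square)
  then have "quad_char (1 / d) = quad_char d"
    using quad_char_mult[OF two, of "d ^ 2" "1 / d"] \<open>d \<noteq> 0\<close> by (simp only:) simp
  ultimately show ?thesis
    by (simp add: card_sqrts[OF two])
qed

text \<open>The curve equation reads \<open>(1 - d * x ^ 2) * y ^ 2 = 1 - x ^ 2\<close>. If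
  \<open>d * x ^ 2 = 1\<close>, the fibre is empty while the character is 0, hence the correction
  term.\<close>

lemma card_edwards_affine_fibre:
  fixes d x :: "'a::finite_field"
  assumes two: "(2 :: 'a) \<noteq> 0" and "d \<noteq> 1"
  shows "int (card {y. (x, y) \<in> edwards_affine d}) =
    1 + quad_char ((1 - x ^ 2) * (1 - d * x ^ 2)) - of_bool (d * x ^ 2 = 1)"
proof -
  have eq: "(x, y) \<in> edwards_affine d \<longleftrightarrow> (1 - d * x ^ 2) * y ^ 2 = 1 - x ^ 2" for y
    by (auto simp: edwards_affine_def algebra_simps)
  show ?thesis
  proof (cases "d * x ^ 2 = 1")
    case True
    with assms have "x ^ 2 \<noteq> 1"
      by auto
    with True show ?thesis
      by (simp add: eq)
  next
    case False
    define e where "e = 1 - d * x ^ 2"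
    have "e \<noteq> 0"
      using False by (simp add: e_def)
    then have "{y. (x, y) \<in> edwards_affine d} = {y. y ^ 2 = (1 - x ^ 2) / e}"
      unfolding eq e_def[symmetric] by (auto simp: field_simps)
    moreover have "(1 - x ^ 2) * e = e ^ 2 * ((1 - x ^ 2) / e)"
      using \<open>e \<noteq> 0\<close> by (simp add: power2_eq_square)
    then have "quad_char ((1 - x ^ 2) * e) = quad_char ((1 - x ^ 2) / e)"
      using \<open>e \<noteq> 0\<close> by (simp only: quad_char_mult[OF two]) simp
    ultimately show ?thesis
      using False by (simp add: card_sqrts[OF two] e_def)
  qed
qed

text \<open>The points at infinity make up twice for the \<open>1 + quad_char d\<close> empty affine
  fibres; the remaining \<open>quad_char d\<close> cancels against the sum over the linear product.
  The result is the point count of \<open>w ^ 2 = t * (1 - t) * (1 - d * t)\<close> with one point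
  at infinity.\<close>

theorem card_edwards_points:
  fixes d :: "'a::finite_field"
  assumes two: "(2 :: 'a) \<noteq> 0" and d: "d \<noteq> 0" "d \<noteq> 1"
  shows "int (card (edwards_points d)) =
    int CARD('a) + 1 + (\<Sum>t\<in>UNIV. quad_char (t * (1 - t) * (1 - d * t)))"
proof -
  have "edwards_affine d = (SIGMA x:UNIV. {y. (x, y) \<in> edwards_affine d})"
    by auto
  then have "int (card (edwards_affine d)) = (\<Sum>x\<in>UNIV. int (card {y. (x, y) \<in> edwards_affine d}))"
    by (metis (no_types, lifting) card_SigmaI finite of_nat_sum sum.cong)
  also have "\<dots> = int CARD('a) + (\<Sum>x\<in>UNIV. quad_char ((1 - x ^ 2) * (1 - d * x ^ 2)))
      - int (card {x. d * x ^ 2 = 1})"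
    by (simp add: card_edwards_affine_fibre[OF two d(2)] sum.distrib sum_subtractf)
  also have "(\<Sum>x\<in>UNIV. quad_char ((1 - x ^ 2) * (1 - d * x ^ 2))) =
      (\<Sum>t\<in>UNIV. (1 + quad_char t) * quad_char ((1 - t) * (1 - d * t)))"
    by (rule sum_quad_char_square[OF two, of "\<lambda>t. quad_char ((1 - t) * (1 - d * t))"])
  also have "\<dots> = - quad_char d + (\<Sum>t\<in>UNIV. quad_char (t * (1 - t) * (1 - d * t)))"
  proof -
    have "quad_char (t * (1 - t) * (1 - d * t)) =
        quad_char t * quad_char ((1 - t) * (1 - d * t))" for t
      by (simp only: mult.assoc quad_char_mult[OF two])
    then show ?thesis
      by (simp only: sum_quad_char_linear_product[OF two d(2), symmetric] distrib_right mult_1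
        sum.distrib)
  qed
  finally show ?thesis
    by (simp add: card_edwards_points_split[OF d(1)] card_scaled_square_eq_1[OF two d(1)])
qed

section \<open>Vanishing of the two sums\<close>

lemma sum_cubic_power:
  fixes d :: "'a::finite_field"
  assumes q: "CARD('a) = 2 * m + 1" and "odd m"
  shows "(\<Sum>t\<in>UNIV. (t * (1 - t) * (1 - d * t)) ^ m) = (\<Sum>j\<le>m. d ^ j * of_nat (m choose j) ^ 2)"
proof -
  define c where "c i j = of_nat (m choose i) * of_nat (m choose j) * (- 1) ^ i * (- d) ^ j" for i j
  have expand: "(1 - s) ^ m = (\<Sum>i\<le>m. of_nat (m choose i) * (- s) ^ i)" for s :: 'a
    using binomial_ring[of "- s" 1 m] by simp
  have "m > 0"
    using \<open>odd m\<close> by (rule odd_pos)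
  have "(\<Sum>t\<in>UNIV. (t * (1 - t) * (1 - d * t)) ^ m) =
      (\<Sum>t\<in>UNIV. \<Sum>i\<le>m. \<Sum>j\<le>m. c i j * t ^ (m + i + j))"
  proof (rule sum.cong [OF refl])
    fix t :: 'a
    have "(t * (1 - t) * (1 - d * t)) ^ m = t ^ m * ((1 - t) ^ m * (1 - d * t) ^ m)"
      by (simp add: power_mult_distrib)
    also have "\<dots> = (\<Sum>i\<le>m. \<Sum>j\<le>m. t ^ m *
        ((of_nat (m choose i) * (- t) ^ i) * (of_nat (m choose j) * (- (d * t)) ^ j)))"
      unfolding expand sum_product unfolding sum_distrib_left ..
    also have "\<dots> = (\<Sum>i\<le>m. \<Sum>j\<le>m. c i j * t ^ (m + i + j))"
    proof (intro sum.cong refl)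
      fix i j
      have "(- t) ^ i = (- 1) ^ i * t ^ i"
        by (rule power_minus)
      moreover have "(- (d * t)) ^ j = (- d) ^ j * t ^ j"
        by (subst power_mult_distrib[symmetric]) simp
      ultimately show "t ^ m * ((of_nat (m choose i) * (- t) ^ i) * (of_nat (m choose j) * (- (d * t)) ^ j)) =
          c i j * t ^ (m + i + j)"
        by (simp add: c_def power_add mult_ac)
    qed
    finally show "(t * (1 - t) * (1 - d * t)) ^ m = (\<Sum>i\<le>m. \<Sum>j\<le>m. c i j * t ^ (m + i + j))" .
  qed
  also have "\<dots> = (\<Sum>i\<le>m. \<Sum>t\<in>UNIV. \<Sum>j\<le>m. c i j * t ^ (m + i + j))"
    by (rule sum.swap)
  also have "\<dots> = (\<Sum>i\<le>m. \<Sum>j\<le>m. \<Sum>t\<in>UNIV. c i j * t ^ (m + i + j))"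
    by (rule sum.cong [OF refl], rule sum.swap)
  \<comment> \<open>The index \<open>i\<close> moves inside because it is the one to be eliminated;
    \<open>j\<close> carries the power of \<open>d\<close>.\<close>
  also have "\<dots> = (\<Sum>j\<le>m. \<Sum>i\<le>m. \<Sum>t\<in>UNIV. c i j * t ^ (m + i + j))"
    by (rule sum.swap)
  also have "\<dots> = (\<Sum>j\<le>m. \<Sum>i\<le>m. c i j * (\<Sum>t\<in>UNIV. t ^ (m + i + j)))"
    by (simp only: sum_distrib_left)
  \<comment> \<open>The exponents lie between \<open>m\<close> and \<open>3 * m\<close>, below
    \<open>4 * m = 2 * (CARD('a) - 1)\<close>, so only the exponent \<open>2 * m\<close> has a
    nonzero power sum, namely -1.\<close>
  also have "\<dots> = (\<Sum>j\<le>m. \<Sum>i\<le>m. if i = m - j then - c i j else 0)"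
  proof (intro sum.cong refl)
    fix i j
    assume "i \<in> {..m}" "j \<in> {..m}"
    then have "m + i + j < 2 * (CARD('a) - 1)" "m + i + j = CARD('a) - 1 \<longleftrightarrow> i = m - j"
      using q \<open>m > 0\<close> by auto
    then show "c i j * (\<Sum>t\<in>UNIV. t ^ (m + i + j)) = (if i = m - j then - c i j else 0)"
      using sum_power_finite_field[of "m + i + j", where 'a = 'a] \<open>m > 0\<close> by simp
  qed
  also have "\<dots> = (\<Sum>j\<le>m. - c (m - j) j)"
    by simp
  also have "\<dots> = (\<Sum>j\<le>m. d ^ j * of_nat (m choose j) ^ 2)"
  proof (intro sum.cong refl)
    fix j
    assume "j \<in> {..m}"
    then have j: "j \<le> m"
      by simp
    \<comment> \<open>The signs combine to \<open>(- 1) ^ m = - 1\<close>, which cancels the minus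
      sign of the power sum.\<close>
    have "(- 1) ^ (m - j) * (- d) ^ j = (- 1) ^ (m - j) * (- 1) ^ j * d ^ j"
      by (simp add: power_minus[of d])
    also have "\<dots> = - (d ^ j)"
      using j \<open>odd m\<close> by (simp flip: power_add)
    finally show "- c (m - j) j = d ^ j * of_nat (m choose j) ^ 2"
      using binomial_symmetric[OF j] by (simp add: c_def power2_eq_square mult.assoc)
  qed
  finally show ?thesis .
qed

text \<open>A reflection of the field negates the cubic, so the sum equals its own negative. The
  codomain of \<open>F\<close> is left general to cover both the field-valued power and the
  integer-valued character.\<close>

lemma sum_odd_cubic_eq_0:
  fixes d :: "'a::finite_field" and F :: "'a \<Rightarrow> 'b::{ring_1, ring_no_zero_divisors}"
  assumes d: "d = 2 \<or> d = inverse 2" and "(2 :: 'a) \<noteq> 0" and "(2 :: 'b) \<noteq> 0"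
    and odd: "\<And>x. F (- x) = - F x"
  shows "(\<Sum>t\<in>UNIV. F (t * (1 - t) * (1 - d * t))) = 0"
proof -
  \<comment> \<open>The roots of the cubic are 0, 1 and \<open>1 / d\<close>. For
    \<open>d = 2\<close> they are symmetric about \<open>1 / 2\<close>, and for
    \<open>d = inverse 2\<close> about 1; \<open>a\<close> is twice that centre.\<close>
  obtain a where a: "(a - t) * (1 - (a - t)) * (1 - d * (a - t)) = - (t * (1 - t) * (1 - d * t))" for t
  proof (cases "d = 2")
    case True
    then show ?thesis
      by (intro that[of 1]) (simp add: algebra_simps)
  next
    case False
    then have "d * 2 = 1"
      using assms by simp
    then have "1 - d * (2 - t) = d * t" "1 - d * t = d * (2 - t)" for t
      by (simp_all add: algebra_simps)
    then show ?thesis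
      by (intro that[of 2]) (simp add: algebra_simps)
  qed
  have "(\<Sum>t\<in>UNIV. F (t * (1 - t) * (1 - d * t))) =
      (\<Sum>t\<in>UNIV. F ((a - t) * (1 - (a - t)) * (1 - d * (a - t))))"
    by (rule sum.reindex_bij_witness[of _ "\<lambda>t. a - t" "\<lambda>t. a - t"]) auto
  also have "\<dots> = - (\<Sum>t\<in>UNIV. F (t * (1 - t) * (1 - d * t)))"
    by (simp only: a odd sum_negf)
  finally have "2 * (\<Sum>t\<in>UNIV. F (t * (1 - t) * (1 - d * t))) = 0"
    by (metis add.right_inverse mult_2)
  then show ?thesis
    using \<open>(2 :: 'b) \<noteq> 0\<close> by simp
qed

theorem theorem2:
  fixes p :: nat and d :: "'p::prime_card mod_ring"
  assumes "p = CARD('p)" and "p mod 4 = 3"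
    and "d = 2 \<or> d = inverse 2"
  shows "(\<Sum>j = 0..(p - 1) div 2. d ^ j * of_nat (((p - 1) div 2) choose j) ^ 2) = 0
    \<and> card (edwards_points d) = p + 1"
proof -
  define m where "m = (p - 1) div 2"
  have m: "CARD('p mod_ring) = 2 * m + 1" "odd m"
    using assms(1,2) unfolding m_def by (simp_all, presburger+)
  \<comment> \<open>The odd number \<open>CARD('p mod_ring)\<close> is zero in the field, so
    \<open>2 = 0\<close> would give \<open>1 = 0\<close>.\<close>
  have two: "(2 :: 'p mod_ring) \<noteq> 0"
    using m of_nat_card_finite_field[where 'a = "'p mod_ring"] by auto
  have "(2 :: 'p mod_ring) \<noteq> 1"
    by (metis add_cancel_right_right one_add_one zero_neq_one)
  with two have d: "d \<noteq> 0" "d \<noteq> 1"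
    using assms(3) by auto
  have "(\<Sum>j\<le>m. d ^ j * of_nat (m choose j) ^ 2) = 0"
    unfolding sum_cubic_power[OF m, symmetric]
    using sum_odd_cubic_eq_0[OF assms(3) two two, of "\<lambda>x. x ^ m"] \<open>odd m\<close> by simp
  \<comment> \<open>Oddness comes from \<open>quad_char (- 1) = - 1\<close>. The character sum then
    vanishes as an integer, which makes the point count exact.\<close>
  moreover have "quad_char (- x) = - quad_char x" for x :: "'p mod_ring"
    using quad_char_mult[OF two, of "- 1" x] quad_char_uminus_1[where 'a = "'p mod_ring"] assms
    by simp
  then have "(\<Sum>t\<in>UNIV. quad_char (t * (1 - t) * (1 - d * t))) = 0"
    using sum_odd_cubic_eq_0[OF assms(3) two, of quad_char] by simp
  then have "int (card (edwards_points d)) = int (p + 1)"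
    using card_edwards_points[OF two d] assms(1) by simp
  ultimately show ?thesis
    by (simp only: m_def atLeast0AtMost of_nat_eq_iff)
qed

end
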